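(* Let $\{w_k^0 : k\in\{1,\dots,m\}\}$ be a set of initial data (points of the parameter space $\Omega$). The solution of the gradient flow $$\partial_t \pi_t = \nabla\cdot\big(\pi_t\, v(\pi_t,w)\big)$$ with initial data $\pi(0)=\frac1m\sum_{k=1}^m \delta_{w_k^0}$ is given by $$\pi(t)=\frac1m\sum_{k=1}^m\delta_{w_k(t)},$$ where $\{w_k(\cdot) : k\in\{1,\dots,m\}\}$ solves the system of ODEs $$\frac{d w_k}{dt} = -v(\pi_t,w_k),\qquad w_k(0)=w_k^0,\qquad k\in\{1,\dots,m\},$$ in which $\pi_t=\pi(t)=\frac1m\sum_{j=1}^m\delta_{w_j(t)}$. (That is, this $\pi(t)$ satisfies the stated initial condition and the equation in the weak sense.)
   Context: Setting: $\varphi(x;w)$ is a real-valued function of a data point $x\in\mathbb{R}^d$ and a parameter $w\in\Omega$ (a Euclidean parameter space), differentiable in $w$; $f^*$ is a real-valued target function; $\mathbb{E}_x$ is expectation over the data distribution. For a probability measure $\pi$ on $\Omega$, define $$f(x;\pi)=\mathbb{E}_{w\sim\pi}[\varphi(x;w)],\qquad v(\pi,w)=\mathbb{E}_x\big[(f(x;\pi)-f^*(x))\,\nabla_w\varphi(x;w)\big].$$ The equation $\partial_t\pi_t=\nabla\cdot(\pi_t v(\pi_t,w))$ for a time-dependent probability measure $\pi_t$ is understood through its weak formulation: for every test function $g$, $$\frac{d}{dt}\int g(w)\,d\pi_t(w) = -\int\langle v(\pi_t,w),\nabla g(w)\rangle\,d\pi_t(w).$$ *)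

theory Defs
  imports "HOL-Probability.Probability"
begin

definition gradient :: "('w::real_inner \<Rightarrow> real) \<Rightarrow> 'w \<Rightarrow> 'w" where
  "gradient g w = (THE D. GDERIV g w :> D)"

lemma gradient_eq:
  assumes "GDERIV g w :> D"
  shows "gradient g w = D"
  unfolding gradient_def
proof (rule the_equality)
  show "GDERIV g w :> D"
    by (rule assms)
next
  fix E assume "GDERIV g w :> E"
  with assms have "(\<lambda>h. h \<bullet> E) = (\<lambda>h. h \<bullet> D)"
    unfolding gderiv_def by (blast intro: has_derivative_unique)
  then have "(E - D) \<bullet> E = (E - D) \<bullet> D"
    by meson
  then have "(E - D) \<bullet> (E - D) = 0"
    by (simp add: inner_diff_right)
  then show "E = D"
    by simp
qed

lemma GDERIV_gradient:
  fixes g :: "'w::euclidean_space \<Rightarrow> real"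
  assumes "g differentiable (at w)"
  shows "GDERIV g w :> gradient g w"
proof -
  obtain g' where g': "(g has_derivative g') (at w)"
    using assms unfolding differentiable_def by blast
  then interpret bounded_linear g'
    by (rule has_derivative_bounded_linear)
  have "g' h = h \<bullet> (\<Sum>b\<in>Basis. g' b *\<^sub>R b)" for h
  proof -
    have "g' h = g' (\<Sum>b\<in>Basis. (h \<bullet> b) *\<^sub>R b)"
      by (simp add: euclidean_representation)
    also have "\<dots> = h \<bullet> (\<Sum>b\<in>Basis. g' b *\<^sub>R b)"
      by (simp add: sum scale inner_sum_right mult.commute)
    finally show ?thesis .
  qed
  then have "g' = (\<lambda>h. h \<bullet> (\<Sum>b\<in>Basis. g' b *\<^sub>R b))"
    by blast
  with g' have "GDERIV g w :> (\<Sum>b\<in>Basis. g' b *\<^sub>R b)"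
    unfolding gderiv_def by metis
  then show ?thesis
    using gradient_eq by metis
qed

definition mean_field :: "('x \<Rightarrow> 'w \<Rightarrow> real) \<Rightarrow> 'x \<Rightarrow> 'w measure \<Rightarrow> real" where
  "mean_field \<phi> x \<pi> = (\<integral>w. \<phi> x w \<partial>\<pi>)"

definition velocity ::
  "'x measure \<Rightarrow> ('x \<Rightarrow> 'w::euclidean_space \<Rightarrow> real) \<Rightarrow> ('x \<Rightarrow> real) \<Rightarrow> 'w measure \<Rightarrow> 'w \<Rightarrow> 'w" where
  "velocity P \<phi> fstar \<pi> w = (\<integral>x. (mean_field \<phi> x \<pi> - fstar x) *\<^sub>R gradient (\<phi> x) w \<partial>P)"

definition empirical :: "nat \<Rightarrow> (nat \<Rightarrow> 'w::topological_space) \<Rightarrow> 'w measure" where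
  "empirical m w = measure_of UNIV (sets borel)
     (\<lambda>A. ennreal (1 / real m) * (\<Sum>k = 1..m. emeasure (return borel (w k)) A))"

lemma sets_empirical [simp, measurable_cong]: "sets (empirical m w) = sets borel"
  unfolding empirical_def
  by (metis sets.sets_measure_of_eq space_borel)

lemma emeasure_empirical:
  assumes "A \<in> sets borel"
  shows "emeasure (empirical m w) A =
    ennreal (1 / real m) * (\<Sum>k = 1..m. emeasure (return borel (w k)) A)"
proof (rule emeasure_measure_of[OF empirical_def])
  show "positive (sets (empirical m w))
      (\<lambda>A. ennreal (1 / real m) * (\<Sum>k = 1..m. emeasure (return borel (w k)) A))"
    by (simp add: positive_def)
  show "countably_additive (sets (empirical m w))
      (\<lambda>A. ennreal (1 / real m) * (\<Sum>k = 1..m. emeasure (return borel (w k)) A))"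
  proof (rule countably_additiveI)
    fix A :: "nat \<Rightarrow> 'a set"
    assume A: "range A \<subseteq> sets (empirical m w)" "disjoint_family A"
    have "(\<Sum>i. ennreal (1 / real m) * (\<Sum>k = 1..m. emeasure (return borel (w k)) (A i))) =
        ennreal (1 / real m) * (\<Sum>k = 1..m. \<Sum>i. emeasure (return borel (w k)) (A i))"
      by (simp add: suminf_sum)
    also have "\<dots> = ennreal (1 / real m) * (\<Sum>k = 1..m. emeasure (return borel (w k)) (\<Union>i. A i))"
      using A by (intro arg_cong2[where f = "(*)"] sum.cong refl suminf_emeasure) auto
    finally show "(\<Sum>i. ennreal (1 / real m) * (\<Sum>k = 1..m. emeasure (return borel (w k)) (A i))) =
        ennreal (1 / real m) * (\<Sum>k = 1..m. emeasure (return borel (w k)) (\<Union>i. A i))" .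
  qed
qed (use assms in auto)

text \<open>Test functions are \<open>C\<^sup>1\<close> with compact support, which includes all smooth compactly
  supported functions.\<close>
definition test_function :: "('w::euclidean_space \<Rightarrow> real) \<Rightarrow> bool" where
  "test_function g \<longleftrightarrow>
     (\<forall>w. g differentiable (at w)) \<and> continuous_on UNIV (gradient g) \<and>
     compact (closure {w. g w \<noteq> 0})"

text \<open>Weak solution of \<open>\<partial>\<^sub>t \<pi>\<^sub>t = \<nabla>\<cdot>(\<pi>\<^sub>t V(\<pi>\<^sub>t, w))\<close> on the time interval \<open>I\<close>. The integrability
  clauses keep the Bochner integrals from silently taking their default value 0.\<close>
definition weak_solution ::
  "('w::euclidean_space measure \<Rightarrow> 'w \<Rightarrow> 'w) \<Rightarrow> real set \<Rightarrow> (real \<Rightarrow> 'w measure) \<Rightarrow> bool" where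
  "weak_solution V I \<pi> \<longleftrightarrow>
     (\<forall>t\<in>I. prob_space (\<pi> t) \<and> sets (\<pi> t) = sets borel) \<and>
     (\<forall>g. test_function g \<longrightarrow> (\<forall>t\<in>I.
        integrable (\<pi> t) g \<and>
        integrable (\<pi> t) (\<lambda>w. V (\<pi> t) w \<bullet> gradient g w) \<and>
        ((\<lambda>s. \<integral>w. g w \<partial>\<pi> s) has_real_derivative
           - (\<integral>w. V (\<pi> t) w \<bullet> gradient g w \<partial>\<pi> t)) (at t within I)))"

end

theory Submission imports Defs begin

text \<open>Integration against an empirical measure is averaging over its atoms, so the weak formulation
  reduces to the chain rule along each trajectory. The only delicate point is the Borel measurability
  of the velocity field in the parameter: a function that is measurable in the data and differentiable
  in the parameter is a Caratheodory function, hence jointly measurable; its gradient is a limit of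
  difference quotients, hence also jointly measurable, and integrating out the data preserves
  measurability.\<close>

text \<open>Second countability makes the identity on the parameter space a pointwise limit of
  simple functions \<open>F i\<close>. With \<open>u\<close> replaced by \<open>F i u\<close>, only
  finitely many sections of \<open>f\<close> occur, and continuity in \<open>u\<close> carries
  measurability to the limit.\<close>

lemma borel_measurable_caratheodory:
  fixes f :: "'x \<Rightarrow> 'w::{second_countable_topology, metric_space} \<Rightarrow> 'b::metric_space"
  assumes meas: "\<And>u. (\<lambda>x. f x u) \<in> borel_measurable M"
    and cont: "\<And>x u. isCont (f x) u"
  shows "(\<lambda>(x, u). f x u) \<in> borel_measurable (M \<Otimes>\<^sub>M borel)"
proof -
  obtain F :: "nat \<Rightarrow> 'w \<Rightarrow> 'w" where F: "\<And>i. simple_function borel (F i)"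
    and lim: "\<And>u. (\<lambda>i. F i u) \<longlonglongrightarrow> u"
    using borel_measurable_implies_sequence_metric[of "\<lambda>u. u" "borel :: 'w measure" undefined]
    by auto
  show ?thesis
  proof (rule borel_measurable_LIMSEQ_metric)
    fix i
    \<comment> \<open>The codomain is the discrete space on the finite range of \<open>F i\<close>,
      so the second argument of \<open>f\<close> can be frozen at one value at a time.\<close>
    have *: "(\<lambda>p. F i (snd p)) \<in> M \<Otimes>\<^sub>M borel \<rightarrow>\<^sub>M count_space (range (F i))"
      using F[of i] by (intro measurable_compose[OF measurable_snd])
        (auto simp: measurable_count_space_eq2 simple_function_def)
    show "(\<lambda>p. f (fst p) (F i (snd p))) \<in> borel_measurable (M \<Otimes>\<^sub>M borel)"
    proof (rule measurable_compose_countable'[OF _ *])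
      show "countable (range (F i))"
        using simple_functionD(1)[OF F[of i]] by (simp add: countable_finite)
      show "(\<lambda>p. f (fst p) u) \<in> borel_measurable (M \<Otimes>\<^sub>M borel)" for u
        using measurable_compose[OF measurable_fst meas[of u]] .
    qed
  next
    fix p
    show "(\<lambda>i. f (fst p) (F i (snd p))) \<longlonglongrightarrow> (case p of (x, u) \<Rightarrow> f x u)"
      using isCont_tendsto_compose[OF cont lim] by (simp add: case_prod_beta)
  qed
qed

text \<open>A full derivative of \<open>g\<close> at \<open>c t\<close> composes with a derivative
  of \<open>c\<close> within \<open>I\<close>, so one-sided derivatives at endpoints of a time
  interval are covered.\<close>

lemma GDERIV_chain_has_vector_derivative:
  assumes "GDERIV g (c t) :> D" and "(c has_vector_derivative c') (at t within I)"
  shows "((\<lambda>s. g (c s)) has_real_derivative c' \<bullet> D) (at t within I)"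
  using has_derivative_compose[OF assms(2)[unfolded has_vector_derivative_def]
      assms(1)[unfolded gderiv_def]]
  by (simp add: has_field_derivative_def mult_commute_abs)

text \<open>The chain rule along the line through \<open>u\<close> in direction \<open>b\<close>,
  sampled at steps 1/(n+1): measurability passes to limits of sequences, so a countable family of
  quotients is wanted.\<close>

lemma GDERIV_difference_quotient_LIMSEQ:
  assumes "GDERIV g u :> D"
  shows "(\<lambda>n. real (Suc n) * (g (u + inverse (real (Suc n)) *\<^sub>R b) - g u)) \<longlonglongrightarrow> b \<bullet> D"
proof -
  have "((\<lambda>s. u + s *\<^sub>R b) has_vector_derivative b) (at 0)"
    by (auto intro!: derivative_eq_intros)
  with assms have "((\<lambda>s. g (u + s *\<^sub>R b)) has_real_derivative b \<bullet> D) (at 0)"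
    by (intro GDERIV_chain_has_vector_derivative) simp_all
  then have "(\<lambda>h. (g (u + h *\<^sub>R b) - g u) / h) \<midarrow>0\<rightarrow> b \<bullet> D"
    by (simp add: DERIV_def)
  \<comment> \<open>Convergence to \<open>at 0\<close> also demands that the steps avoid 0
    itself.\<close>
  moreover have "filterlim (\<lambda>n. inverse (real (Suc n))) (at 0) sequentially"
    using LIMSEQ_inverse_real_of_nat by (auto simp: filterlim_at)
  ultimately have "(\<lambda>n. (g (u + inverse (real (Suc n)) *\<^sub>R b) - g u) / inverse (real (Suc n)))
      \<longlonglongrightarrow> b \<bullet> D"
    by (rule filterlim_compose)
  then show ?thesis
    by (simp add: divide_inverse mult.commute)
qed

text \<open>It suffices to treat the inner product with each fixed vector \<open>b\<close>, a
  real-valued limit of jointly measurable difference quotients.\<close>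

lemma borel_measurable_gradient:
  fixes f :: "'x \<Rightarrow> 'w::euclidean_space \<Rightarrow> real"
  assumes meas: "\<And>u. (\<lambda>x. f x u) \<in> borel_measurable M"
    and diff: "\<And>x u. f x differentiable (at u)"
  shows "(\<lambda>(x, u). gradient (f x) u) \<in> borel_measurable (M \<Otimes>\<^sub>M borel)"
proof -
  have joint: "(\<lambda>(x, u). f x u) \<in> borel_measurable (M \<Otimes>\<^sub>M borel)"
    using meas diff by (intro borel_measurable_caratheodory differentiable_imp_continuous_within)
  have shift: "(\<lambda>p. f (fst p) (snd p + c)) \<in> borel_measurable (M \<Otimes>\<^sub>M borel)" for c
  proof -
    have "(\<lambda>p. (fst p, snd p + c)) \<in> M \<Otimes>\<^sub>M borel \<rightarrow>\<^sub>M M \<Otimes>\<^sub>M borel"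
      by measurable
    from measurable_compose[OF this joint] show ?thesis
      by simp
  qed
  have "(\<lambda>p. b \<bullet> gradient (f (fst p)) (snd p)) \<in> borel_measurable (M \<Otimes>\<^sub>M borel)" for b
  proof (rule borel_measurable_LIMSEQ_metric)
    show "(\<lambda>p. real (Suc n) * (f (fst p) (snd p + inverse (real (Suc n)) *\<^sub>R b)
        - f (fst p) (snd p))) \<in> borel_measurable (M \<Otimes>\<^sub>M borel)" for n
      \<comment> \<open>The instance with shift 0 handles the unshifted term of the
        quotient.\<close>
      using shift shift[of 0] by (intro borel_measurable_times borel_measurable_diff) auto
    show "(\<lambda>n. real (Suc n) * (f (fst p) (snd p + inverse (real (Suc n)) *\<^sub>R b)
        - f (fst p) (snd p))) \<longlonglongrightarrow> b \<bullet> gradient (f (fst p)) (snd p)" for p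
      using GDERIV_difference_quotient_LIMSEQ[OF GDERIV_gradient[OF diff]] .
  qed
  then show ?thesis
    unfolding case_prod_beta
    by (subst borel_measurable_euclidean_space) (simp add: inner_commute)
qed

text \<open>Both measures give \<open>A\<close> the number of indices mapped into \<open>A\<close>,
  divided by \<open>m\<close>; coinciding points count with multiplicity. Image-measure results then
  apply.\<close>

lemma empirical_eq_distr:
  assumes "m \<ge> 1"
  shows "empirical m w = distr (uniform_count_measure {1..m}) borel w"
proof (rule measure_eqI)
  fix A assume "A \<in> sets (empirical m w)"
  then have A: "A \<in> sets borel"
    by simp
  have "(\<Sum>k = 1..m. emeasure (return borel (w k)) A) = of_nat (card (w -` A \<inter> {1..m}))"
  proof -
    have "(\<Sum>k = 1..m. emeasure (return borel (w k)) A) =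
        (\<Sum>k = 1..m. indicator (w -` A) k :: ennreal)"
      using A by (intro sum.cong) (auto simp: indicator_def)
    also have "\<dots> = of_nat (card (w -` A \<inter> {1..m}))"
      by (simp add: indicator_def of_bool_def sum.If_cases Int_commute vimage_def)
    finally show ?thesis .
  qed
  then have "emeasure (empirical m w) A = ennreal (real (card (w -` A \<inter> {1..m})) / real m)"
    using A by (simp add: emeasure_empirical ennreal_of_nat_eq_real_of_nat
        flip: ennreal_mult)
  also have "\<dots> = emeasure (uniform_count_measure {1..m}) (w -` A \<inter> {1..m})"
    by (subst emeasure_uniform_count_measure) auto
  also have "\<dots> = emeasure (distr (uniform_count_measure {1..m}) borel w) A"
    using A by (subst emeasure_distr)
      (auto simp: space_uniform_count_measure sets_uniform_count_measure measurable_def)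
  finally show "emeasure (empirical m w) A =
      emeasure (distr (uniform_count_measure {1..m}) borel w) A" .
qed simp

text \<open>Pulled back along \<open>w\<close>, the integral lives on a finite uniform space, where
  every real function is measurable and integrable. Borel measurability of \<open>g\<close> is what
  the change of variables requires.\<close>

lemma
  fixes w :: "nat \<Rightarrow> 'w::topological_space" and g :: "'w \<Rightarrow> real"
  assumes "m \<ge> 1"
  shows prob_space_empirical: "prob_space (empirical m w)"
    and integrable_empirical: "g \<in> borel_measurable borel \<Longrightarrow> integrable (empirical m w) g"
    and integral_empirical: "g \<in> borel_measurable borel \<Longrightarrow>
      (\<integral>u. g u \<partial>empirical m w) = (\<Sum>k = 1..m. g (w k)) / real m"
proof -
  have w: "w \<in> uniform_count_measure {1..m} \<rightarrow>\<^sub>M borel"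
    by (auto simp: measurable_def space_uniform_count_measure sets_uniform_count_measure)
  interpret U: prob_space "uniform_count_measure {1..m}"
    using assms by (intro prob_space_uniform_count_measure) auto
  show "prob_space (empirical m w)"
    using U.prob_space_distr[OF w] by (simp add: empirical_eq_distr[OF assms])
  show "integrable (empirical m w) g" if "g \<in> borel_measurable borel"
    using that w by (simp add: empirical_eq_distr[OF assms] integrable_distr_eq
        uniform_count_measure_def integrable_point_measure_finite)
  show "(\<integral>u. g u \<partial>empirical m w) = (\<Sum>k = 1..m. g (w k)) / real m"
    if "g \<in> borel_measurable borel"
    using that w by (simp add: empirical_eq_distr[OF assms] integral_distr
        lebesgue_integral_point_measure_finite uniform_count_measure_def sum_divide_distrib)
qed

lemma empirical_cong:
  assumes "\<And>k. k \<in> {1..m} \<Longrightarrow> w k = w' k"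
  shows "empirical m w = empirical m w'"
  using assms by (simp add: empirical_def)

text \<open>Against an empirical measure the mean field is a finite average of functions measurable
  in \<open>x\<close>. The integrand of the velocity is therefore jointly measurable, and so is its
  integral as a function of the parameter.\<close>

lemma borel_measurable_velocity_empirical:
  fixes P :: "'x measure" and \<phi> :: "'x \<Rightarrow> 'w::euclidean_space \<Rightarrow> real"
  assumes "sigma_finite_measure P"
    and meas: "\<And>u. (\<lambda>x. \<phi> x u) \<in> borel_measurable P"
    and diff: "\<And>x u. \<phi> x differentiable (at u)"
    and fstar: "fstar \<in> borel_measurable P"
    and "m \<ge> 1"
  shows "velocity P \<phi> fstar (empirical m w) \<in> borel_measurable borel"
proof -
  interpret sigma_finite_measure P by fact
  have "\<phi> x \<in> borel_measurable borel" for x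
    using diff by (intro borel_measurable_continuous_onI continuous_at_imp_continuous_on)
      (auto intro: differentiable_imp_continuous_within)
  then have "mean_field \<phi> x (empirical m w) = (\<Sum>k = 1..m. \<phi> x (w k)) / real m" for x
    by (simp add: mean_field_def integral_empirical[OF \<open>m \<ge> 1\<close>])
  then have res: "(\<lambda>x. mean_field \<phi> x (empirical m w) - fstar x) \<in> borel_measurable P"
    using meas fstar by simp
  \<comment> \<open>The coordinates are swapped because the variable to be integrated out must come
    second.\<close>
  have grad: "(\<lambda>p. gradient (\<phi> (snd p)) (fst p)) \<in> borel_measurable (borel \<Otimes>\<^sub>M P)"
    using measurable_compose[OF measurable_pair_swap' borel_measurable_gradient[OF meas diff]]
    by (simp add: case_prod_beta)
  have "(\<lambda>(u, x). (mean_field \<phi> x (empirical m w) - fstar x) *\<^sub>R gradient (\<phi> x) u)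
      \<in> borel_measurable (borel \<Otimes>\<^sub>M P)"
    unfolding case_prod_beta
    by (intro borel_measurable_scaleR grad measurable_compose[OF measurable_snd res])
  \<comment> \<open>This covers parameters at which the integrand is not integrable: the Bochner
    integral is 0 there.\<close>
  from borel_measurable_lebesgue_integral[OF this] show ?thesis
    by (simp add: velocity_def[abs_def])
qed

theorem lemma1:
  fixes P :: "(real ^ 'd) measure"
    and \<phi> :: "real ^ 'd \<Rightarrow> 'w::euclidean_space \<Rightarrow> real"
    and fstar :: "real ^ 'd \<Rightarrow> real"
    and m :: nat
    and w0 :: "nat \<Rightarrow> 'w"
    and w :: "nat \<Rightarrow> real \<Rightarrow> 'w"
    and I :: "real set"
    and \<pi> :: "real \<Rightarrow> 'w measure"
  assumes "prob_space P" and "sets P = sets borel"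
    and "\<And>u. (\<lambda>x. \<phi> x u) \<in> borel_measurable P"
    and "\<And>x u. \<phi> x differentiable (at u)"
    and "fstar \<in> borel_measurable P"
    and "m \<ge> 1"
    and "is_interval I" and "0 \<in> I"
    and "\<And>t. \<pi> t = empirical m (\<lambda>k. w k t)"
    and "\<And>k. k \<in> {1..m} \<Longrightarrow> w k 0 = w0 k"
    and "\<And>k t. k \<in> {1..m} \<Longrightarrow> t \<in> I \<Longrightarrow>
      (w k has_vector_derivative - velocity P \<phi> fstar (\<pi> t) (w k t)) (at t within I)"
  shows "\<pi> 0 = empirical m w0 \<and> weak_solution (velocity P \<phi> fstar) I \<pi>"
proof
  show "\<pi> 0 = empirical m w0"
    unfolding assms(9) using assms(10) by (rule empirical_cong)
  interpret P: prob_space P by fact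
  let ?V = "velocity P \<phi> fstar"
  \<comment> \<open>Although \<open>\<pi> t\<close> is carried by finitely many points, its
    sigma-algebra is the Borel one, so integrability needs a Borel measurable integrand.\<close>
  have V: "?V (\<pi> t) \<in> borel_measurable borel" for t
    unfolding assms(9)
    by (intro borel_measurable_velocity_empirical P.sigma_finite_measure_axioms assms)
  show "weak_solution ?V I \<pi>"
    unfolding weak_solution_def
  proof (intro conjI ballI allI impI)
    fix t
    show "prob_space (\<pi> t)" "sets (\<pi> t) = sets borel"
      using prob_space_empirical[OF \<open>m \<ge> 1\<close>] by (simp_all add: assms(9))
  next
    fix g :: "'w \<Rightarrow> real" and t
    assume g: "test_function g" and t: "t \<in> I"
    have diff: "g differentiable (at u)" for u
      using g by (simp add: test_function_def)
    have g_meas: "g \<in> borel_measurable borel"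
      using diff by (intro borel_measurable_continuous_onI continuous_at_imp_continuous_on)
        (auto intro: differentiable_imp_continuous_within)
    have "gradient g \<in> borel_measurable borel"
      using g by (intro borel_measurable_continuous_onI) (simp add: test_function_def)
    with V have Vg_meas: "(\<lambda>u. ?V (\<pi> t) u \<bullet> gradient g u) \<in> borel_measurable borel"
      by (intro borel_measurable_inner)
    show "integrable (\<pi> t) g"
      using integrable_empirical[OF \<open>m \<ge> 1\<close> g_meas] by (simp add: assms(9))
    show "integrable (\<pi> t) (\<lambda>u. ?V (\<pi> t) u \<bullet> gradient g u)"
      using integrable_empirical[OF \<open>m \<ge> 1\<close> Vg_meas] by (simp add: assms(9))
    have "((\<lambda>s. g (w k s)) has_real_derivative - ?V (\<pi> t) (w k t) \<bullet> gradient g (w k t))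
        (at t within I)" if "k \<in> {1..m}" for k
      using GDERIV_gradient[OF diff] assms(11)[OF that t]
      by (rule GDERIV_chain_has_vector_derivative)
    \<comment> \<open>The average is a finite sum, so differentiation passes through it without any
      domination argument.\<close>
    then have "((\<lambda>s. (\<Sum>k = 1..m. g (w k s)) / real m) has_real_derivative
        (\<Sum>k = 1..m. - ?V (\<pi> t) (w k t) \<bullet> gradient g (w k t)) / real m) (at t within I)"
      by (intro DERIV_cdivide DERIV_sum)
    \<comment> \<open>The formula is needed at every \<open>s\<close>, since it rewrites the
      function being differentiated; the velocity integral below is needed only at
      \<open>t\<close>.\<close>
    moreover have "(\<integral>u. g u \<partial>\<pi> s) = (\<Sum>k = 1..m. g (w k s)) / real m" for s
      unfolding assms(9) by (rule integral_empirical[OF \<open>m \<ge> 1\<close> g_meas])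
    moreover have "(\<integral>u. ?V (\<pi> t) u \<bullet> gradient g u \<partial>\<pi> t) =
        (\<Sum>k = 1..m. ?V (\<pi> t) (w k t) \<bullet> gradient g (w k t)) / real m"
      using integral_empirical[OF \<open>m \<ge> 1\<close> Vg_meas, of "\<lambda>k. w k t"] by (simp add: assms(9))
    ultimately show "((\<lambda>s. \<integral>u. g u \<partial>\<pi> s) has_real_derivative
        - (\<integral>u. ?V (\<pi> t) u \<bullet> gradient g u \<partial>\<pi> t)) (at t within I)"
      by (simp add: sum_negf)
  qed
qed

end
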